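(* Let $G$ be a finite group, $H\le G$, and $S\subset G$ such that $S=HSH$ and $S\cap H=\emptyset$. If $K$ with $H\le K\le G$ is chosen to be maximal such that $S=KSK$, $\mathcal{B}$ is the set of left cosets of $K$ in $G$, and $n=[K:H]$, then $$\mathrm{Aut}(\mathrm{Cos}(G,H,S))\cong(\mathrm{Aut}(\mathrm{Cay}(G,S))/\mathcal{B})\wr S_n.$$
   Context: For $H\le G$ and $S\subset G$ with $S\cap H=\emptyset$ and $HSH=S$, the double coset digraph $\mathrm{Cos}(G,H,S)$ has as vertices the left cosets of $H$ in $G$ and arc set $\{(gH,gsH):g\in G,s\in S\}$; $H$ is not required to be core-free. For $S\subset G$ with $1\notin S$, the Cayley digraph $\mathrm{Cay}(G,S)$ has vertex set $G$ and arc set $\{(g,gs):g\in G,s\in S\}$. If $A$ is a transitive permutation group with a block system $\mathcal{B}$ (a partition of the permuted set into blocks permuted by $A$), then $A/\mathcal{B}$ denotes the permutation group on the set $\mathcal{B}$ induced by $A$. For permutation groups $P\le S_X$, $Q\le S_Y$, the wreath product $P\wr Q$ is the group of all permutations of $X\times Y$ of the form $(x,y)\mapsto(p(x),q_x(y))$ with $p\in P$ and each $q_x\in Q$. $S_n$ is the symmetric group acting on $n$ points. *)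

theory Defs
  imports
    "Graph_Theory.Pair_Digraph"
    "HOL-Library.Disjoint_Sets"
    "HOL-Algebra.Left_Coset"
    "HOL-Algebra.Sym_Groups"
begin

text \<open>
  A permutation of a set \<open>X\<close> is a function with \<open>\<sigma> permutes X\<close>, i.e. it is the identity
  outside \<open>X\<close>. A permutation group on \<open>X\<close> is given by the set of its elements; the
  convention agrees with \<^const>\<open>sym_group\<close>.
\<close>

definition perm_group :: "('v \<Rightarrow> 'v) set \<Rightarrow> ('v \<Rightarrow> 'v) monoid"
  where "perm_group A = \<lparr> carrier = A, mult = (\<circ>), one = id \<rparr>"

definition double_coset_digraph ::
    "('a, 'b) monoid_scheme \<Rightarrow> 'a set \<Rightarrow> 'a set \<Rightarrow> 'a set pair_pre_digraph"
  where "double_coset_digraph G H S =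
    \<lparr> pverts = lcosets\<^bsub>G\<^esub> H,
      parcs = {(g <#\<^bsub>G\<^esub> H, (g \<otimes>\<^bsub>G\<^esub> s) <#\<^bsub>G\<^esub> H) | g s. g \<in> carrier G \<and> s \<in> S} \<rparr>"

definition cayley_digraph ::
    "('a, 'b) monoid_scheme \<Rightarrow> 'a set \<Rightarrow> 'a pair_pre_digraph"
  where "cayley_digraph G S =
    \<lparr> pverts = carrier G,
      parcs = {(g, g \<otimes>\<^bsub>G\<^esub> s) | g s. g \<in> carrier G \<and> s \<in> S} \<rparr>"

definition digraph_aut :: "'v pair_pre_digraph \<Rightarrow> ('v \<Rightarrow> 'v) set"
  where "digraph_aut D =
    {\<sigma>. \<sigma> permutes pverts D \<and>
         (\<forall>u\<in>pverts D. \<forall>v\<in>pverts D. (u, v) \<in> parcs D \<longleftrightarrow> (\<sigma> u, \<sigma> v) \<in> parcs D)}"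

definition transitive_perms :: "'v set \<Rightarrow> ('v \<Rightarrow> 'v) set \<Rightarrow> bool"
  where "transitive_perms X A \<longleftrightarrow> (\<forall>x\<in>X. \<forall>y\<in>X. \<exists>\<sigma>\<in>A. \<sigma> x = y)"

definition block_system :: "'v set \<Rightarrow> ('v \<Rightarrow> 'v) set \<Rightarrow> 'v set set \<Rightarrow> bool"
  where "block_system X A \<B> \<longleftrightarrow>
    transitive_perms X A \<and> partition_on X \<B> \<and> (\<forall>\<sigma>\<in>A. \<forall>B\<in>\<B>. \<sigma> ` B \<in> \<B>)"

text \<open>
  The group \<open>A/\<B>\<close> induced on the blocks; meaningful when \<open>\<B>\<close> is a block system of \<open>A\<close>.
\<close>

definition induced_on_blocks :: "('v \<Rightarrow> 'v) set \<Rightarrow> 'v set set \<Rightarrow> ('v set \<Rightarrow> 'v set) set"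
  where "induced_on_blocks A \<B> = (\<lambda>\<sigma> B. if B \<in> \<B> then \<sigma> ` B else B) ` A"

definition wreath_product ::
    "'x set \<Rightarrow> ('x \<Rightarrow> 'x) set \<Rightarrow> 'y set \<Rightarrow> ('y \<Rightarrow> 'y) set \<Rightarrow> ('x \<times> 'y \<Rightarrow> 'x \<times> 'y) set"
  where "wreath_product X P Y Q =
    {f. f permutes (X \<times> Y) \<and>
        (\<exists>p\<in>P. \<exists>q. (\<forall>x\<in>X. q x \<in> Q) \<and> (\<forall>x\<in>X. \<forall>y\<in>Y. f (x, y) = (p x, q x y)))}"

text \<open>
  Isomorphism of permutation groups: an isomorphism of groups together with a bijection of
  the permuted sets that intertwines the two actions.
\<close>

definition perm_isomorphic ::
    "'v set \<Rightarrow> ('v \<Rightarrow> 'v) set \<Rightarrow> 'w set \<Rightarrow> ('w \<Rightarrow> 'w) set \<Rightarrow> bool"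
  where "perm_isomorphic X A Y B \<longleftrightarrow>
    (\<exists>\<phi> \<psi>. bij_betw \<phi> X Y \<and> \<psi> \<in> iso (perm_group A) (perm_group B) \<and>
       (\<forall>\<sigma>\<in>A. \<forall>x\<in>X. \<phi> (\<sigma> x) = \<psi> \<sigma> (\<phi> x)))"

lemma perm_isomorphic_imp_iso:
  "perm_isomorphic X A Y B \<Longrightarrow> perm_group A \<cong> perm_group B"
  unfolding perm_isomorphic_def is_iso_def by blast

lemma perm_group_sym_group: "perm_group (carrier (sym_group n)) = sym_group n"
  by (simp add: perm_group_def sym_group_def)

end

theory Submission
  imports Defs
begin

text \<open>
  Two vertices of a digraph are twins if they have the same out-neighbours and the same
  in-neighbours. Being twins is preserved by every automorphism, and any permutation that
  fixes each twin class setwise is an automorphism; this is where both the block system and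
  the wreath product come from.

  The arcs of \<open>Cos(G,K,S)\<close>, \<open>Cos(G,H,S)\<close> and \<open>Cay(G,S)\<close> are all given by the same test
  \<open>a\<^sup>-\<^sup>1b \<in> S\<close> on representatives. Since \<open>S = KSK\<close>, both \<open>Cos(G,H,S)\<close> and \<open>Cay(G,S)\<close> are therefore
  the full preimage of \<open>Q = Cos(G,K,S)\<close> under \<open>gH \<mapsto> gK\<close> and \<open>g \<mapsto> gK\<close>; the fibres have
  constant sizes \<open>[K:H]\<close> and \<open>|K|\<close>. Maximality of \<open>K\<close> says that \<open>K\<close> is the two-sided stabilizer
  of \<open>S\<close>, since that stabilizer is a subgroup containing \<open>K\<close> under which \<open>S\<close> is bi-invariant.
  If \<open>aK\<close> and \<open>bK\<close> are twins in \<open>Q\<close> then \<open>a\<^sup>-\<^sup>1b\<close> stabilizes \<open>S\<close> on both sides, so \<open>aK = bK\<close>: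
  the digraph \<open>Q\<close> has no distinct twins, and the fibres above are exactly the twin classes.

  For any digraph \<open>D\<close> lying over a twin-free \<open>Q\<close> in this way with fibres of size \<open>m\<close>,
  automorphisms of \<open>D\<close> descend to \<open>Q\<close>, and a permutation of the vertices of \<open>D\<close> that covers
  an automorphism of \<open>Q\<close> is an automorphism. Labelling each fibre by \<open>1, \<dots>, m\<close> turns this into
  \<open>Aut(D) \<cong> Aut(Q) \<wr> S\<^sub>m\<close> (\<open>aut_perm_isomorphic_wreath\<close>). Since fibres are equally large, every
  automorphism of \<open>Q\<close> is covered by one of \<open>D\<close>; so \<open>Aut(D)\<close> induces exactly \<open>Aut(Q)\<close> on the
  fibres (\<open>induced_on_fibres_eq_aut\<close>). The theorem combines the wreath decomposition for
  \<open>D = Cos(G,H,S)\<close> with the identification of the induced group for \<open>D = Cay(G,S)\<close>.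
\<close>

section \<open>Transport of permutations along a bijection\<close>

text \<open>
  Conjugation with a bijection of the permuted sets is always an isomorphism of the full
  symmetric groups, so a permutation isomorphism between \<open>A\<close> and \<open>B\<close> only needs membership in
  \<open>A\<close> and \<open>B\<close> to correspond for intertwined permutations.
\<close>

lemma perm_isomorphicI:
  assumes \<phi>: "bij_betw \<phi> X Y"
    and A: "\<And>\<sigma>. \<sigma> \<in> A \<Longrightarrow> \<sigma> permutes X"
    and B: "\<And>\<tau>. \<tau> \<in> B \<Longrightarrow> \<tau> permutes Y"
    and corr: "\<And>\<sigma> \<tau>. \<lbrakk>\<sigma> permutes X; \<tau> permutes Y; \<And>x. x \<in> X \<Longrightarrow> \<tau> (\<phi> x) = \<phi> (\<sigma> x)\<rbrakk>
      \<Longrightarrow> \<sigma> \<in> A \<longleftrightarrow> \<tau> \<in> B"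
  shows "perm_isomorphic X A Y B"
proof -
  define \<psi> where "\<psi> = map_permutation X \<phi>"
  have inj: "inj_on \<phi> X" and Y: "\<phi> ` X = Y"
    using \<phi> by (auto simp: bij_betw_def)
  have equiv: "\<psi> \<sigma> (\<phi> x) = \<phi> (\<sigma> x)" if "x \<in> X" for \<sigma> x
    unfolding \<psi>_def using map_permutation_apply[OF inj that] .
  have perm: "\<psi> \<sigma> permutes Y" if "\<sigma> permutes X" for \<sigma>
    unfolding \<psi>_def using map_permutation_permutes[OF \<phi> that] .
  have eqI: "\<tau> = \<tau>'" if "\<tau> permutes Y" "\<tau>' permutes Y" "\<And>x. x \<in> X \<Longrightarrow> \<tau> (\<phi> x) = \<tau>' (\<phi> x)" for \<tau> \<tau>'
  proof
    fix y show "\<tau> y = \<tau>' y"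
      using that Y by (cases "y \<in> Y") (auto simp: permutes_not_in)
  qed
  have "\<psi> \<in> hom (perm_group A) (perm_group B)"
  proof (rule homI)
    fix \<sigma> assume "\<sigma> \<in> carrier (perm_group A)"
    then have "\<sigma> \<in> A" by (simp add: perm_group_def)
    then show "\<psi> \<sigma> \<in> carrier (perm_group B)"
      using corr[OF A perm] A equiv by (simp add: perm_group_def)
  next
    fix \<sigma> \<rho> assume "\<sigma> \<in> carrier (perm_group A)" "\<rho> \<in> carrier (perm_group A)"
    then have *: "\<sigma> permutes X" "\<rho> permutes X" using A by (auto simp: perm_group_def)
    have "\<psi> (\<sigma> \<circ> \<rho>) = \<psi> \<sigma> \<circ> \<psi> \<rho>"
      unfolding \<psi>_def using map_permutation_compose'[OF inj *(2)] .
    then show "\<psi> (\<sigma> \<otimes>\<^bsub>perm_group A\<^esub> \<rho>) = \<psi> \<sigma> \<otimes>\<^bsub>perm_group B\<^esub> \<psi> \<rho>"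
      by (simp add: perm_group_def)
  qed
  moreover have "bij_betw \<psi> A B"
    unfolding bij_betw_def
  proof
    show "inj_on \<psi> A"
    proof
      fix \<sigma> \<rho> assume *: "\<sigma> \<in> A" "\<rho> \<in> A" "\<psi> \<sigma> = \<psi> \<rho>"
      show "\<sigma> = \<rho>"
      proof
        fix x
        show "\<sigma> x = \<rho> x"
        proof (cases "x \<in> X")
          case True
          then have "\<phi> (\<sigma> x) = \<phi> (\<rho> x)" using equiv * by metis
          moreover have "\<sigma> x \<in> X" "\<rho> x \<in> X" using True * A by (auto simp: permutes_in_image)
          ultimately show ?thesis using inj by (auto dest: inj_onD)
        qed (use A[OF *(1)] A[OF *(2)] in \<open>simp add: permutes_not_in\<close>)
      qed
    qed
    show "\<psi> ` A = B"
    proof (intro equalityI subsetI)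
      fix \<tau> assume "\<tau> \<in> \<psi> ` A"
      then show "\<tau> \<in> B" using corr[OF A perm] A equiv by auto
    next
      fix \<tau> assume \<tau>: "\<tau> \<in> B"
      define \<sigma> where "\<sigma> = map_permutation Y (inv_into X \<phi>) \<tau>"
      have \<phi>': "bij_betw (inv_into X \<phi>) Y X" using \<phi> by (rule bij_betw_inv_into)
      have \<sigma>: "\<sigma> permutes X"
        unfolding \<sigma>_def using map_permutation_permutes[OF \<phi>' B[OF \<tau>]] .
      have "\<tau> (\<phi> x) = \<phi> (\<sigma> x)" if x: "x \<in> X" for x
      proof -
        have y: "\<phi> x \<in> Y" using x Y by blast
        have "\<sigma> (inv_into X \<phi> (\<phi> x)) = inv_into X \<phi> (\<tau> (\<phi> x))"
          unfolding \<sigma>_def using map_permutation_apply \<phi>' y by (metis bij_betw_imp_inj_on)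
        moreover have "\<tau> (\<phi> x) \<in> \<phi> ` X" using y B[OF \<tau>] Y by (simp add: permutes_in_image)
        ultimately show ?thesis using x inj by (simp add: f_inv_into_f)
      qed
      note * = this
      have "\<sigma> \<in> A" using corr[OF \<sigma> B[OF \<tau>] *] \<tau> by simp
      moreover have "\<psi> \<sigma> = \<tau>"
        by (rule eqI[OF perm[OF \<sigma>] B[OF \<tau>]]) (simp add: equiv *)
      ultimately show "\<tau> \<in> \<psi> ` A" by blast
    qed
  qed
  ultimately have "\<psi> \<in> iso (perm_group A) (perm_group B)"
    by (simp add: iso_def perm_group_def)
  then show ?thesis
    unfolding perm_isomorphic_def using \<phi> equiv by metis
qed

section \<open>Automorphisms of a digraph over its twin-free quotient\<close>

text \<open>
  \<open>D\<close> arises from the twin-free digraph \<open>Q\<close> by replacing every vertex with \<open>m\<close> twins. Loops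
  are allowed in \<open>Q\<close>; a loop at \<open>a\<close> makes the fibre over \<open>a\<close> complete instead of arcless.
\<close>

locale twin_quotient =
  fixes D :: "'v pair_pre_digraph" and Q :: "'w pair_pre_digraph"
    and \<pi> :: "'v \<Rightarrow> 'w" and m :: nat
  assumes finite_verts: "finite (pverts D)"
    and onto: "\<pi> ` pverts D = pverts Q"
    and arc_iff: "\<lbrakk>u \<in> pverts D; v \<in> pverts D\<rbrakk> \<Longrightarrow> (u, v) \<in> parcs D \<longleftrightarrow> (\<pi> u, \<pi> v) \<in> parcs Q"
    and twin_free: "\<lbrakk>a \<in> pverts Q; b \<in> pverts Q;
      \<And>c. c \<in> pverts Q \<Longrightarrow> (a, c) \<in> parcs Q \<longleftrightarrow> (b, c) \<in> parcs Q;
      \<And>c. c \<in> pverts Q \<Longrightarrow> (c, a) \<in> parcs Q \<longleftrightarrow> (c, b) \<in> parcs Q\<rbrakk> \<Longrightarrow> a = b"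
    and card_fibre: "a \<in> pverts Q \<Longrightarrow> card {v \<in> pverts D. \<pi> v = a} = m"
begin

definition covers :: "('v \<Rightarrow> 'v) \<Rightarrow> ('w \<Rightarrow> 'w) \<Rightarrow> bool"
  where "covers \<sigma> p \<longleftrightarrow> (\<forall>u\<in>pverts D. p (\<pi> u) = \<pi> (\<sigma> u))"

text \<open>
  The fibres of \<open>\<pi>\<close> are described by the arcs of \<open>D\<close> alone, as twin classes. Hence every
  automorphism of \<open>D\<close> permutes them.
\<close>

lemma same_fibre_iff:
  assumes "u \<in> pverts D" "v \<in> pverts D"
  shows "\<pi> u = \<pi> v \<longleftrightarrow> (\<forall>w\<in>pverts D.
    ((u, w) \<in> parcs D \<longleftrightarrow> (v, w) \<in> parcs D) \<and> ((w, u) \<in> parcs D \<longleftrightarrow> (w, v) \<in> parcs D))"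
    (is "_ \<longleftrightarrow> ?twins")
proof
  assume "\<pi> u = \<pi> v" then show ?twins using assms by (simp add: arc_iff)
next
  assume ?twins
  then show "\<pi> u = \<pi> v" using assms onto
    by (intro twin_free) (auto simp flip: onto simp: arc_iff)
qed

lemma aut_preserves_fibres:
  assumes \<sigma>: "\<sigma> \<in> digraph_aut D" and uv: "u \<in> pverts D" "v \<in> pverts D"
  shows "\<pi> (\<sigma> u) = \<pi> (\<sigma> v) \<longleftrightarrow> \<pi> u = \<pi> v"
proof -
  have p: "\<sigma> permutes pverts D"
    and arc: "\<And>x y. \<lbrakk>x \<in> pverts D; y \<in> pverts D\<rbrakk> \<Longrightarrow> (\<sigma> x, \<sigma> y) \<in> parcs D \<longleftrightarrow> (x, y) \<in> parcs D"
    using \<sigma> by (auto simp: digraph_aut_def)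
  have mem: "\<sigma> u \<in> pverts D" "\<sigma> v \<in> pverts D" using uv p by (auto simp: permutes_in_image)
  \<comment> \<open>All vertices have the form \<open>\<sigma> w\<close>, so \<open>\<sigma>\<close> can be cancelled from the arcs.\<close>
  have "\<pi> (\<sigma> u) = \<pi> (\<sigma> v) \<longleftrightarrow> (\<forall>w\<in>\<sigma> ` pverts D.
    ((\<sigma> u, w) \<in> parcs D \<longleftrightarrow> (\<sigma> v, w) \<in> parcs D) \<and> ((w, \<sigma> u) \<in> parcs D \<longleftrightarrow> (w, \<sigma> v) \<in> parcs D))"
    using same_fibre_iff[OF mem] permutes_image[OF p] by simp
  also have "\<dots> \<longleftrightarrow> \<pi> u = \<pi> v"
    using uv by (simp add: same_fibre_iff[OF uv] arc)
  finally show ?thesis .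
qed

lemma aut_descends:
  assumes \<sigma>: "\<sigma> \<in> digraph_aut D"
  obtains p where "p \<in> digraph_aut Q" "covers \<sigma> p"
proof -
  have perm: "\<sigma> permutes pverts D"
    and arc: "\<And>x y. \<lbrakk>x \<in> pverts D; y \<in> pverts D\<rbrakk> \<Longrightarrow> (\<sigma> x, \<sigma> y) \<in> parcs D \<longleftrightarrow> (x, y) \<in> parcs D"
    using \<sigma> by (auto simp: digraph_aut_def)
  have mem: "\<sigma> u \<in> pverts D \<longleftrightarrow> u \<in> pverts D" for u using perm by (rule permutes_in_image)
  define p where
    "p a = (if a \<in> pverts Q then \<pi> (\<sigma> (inv_into (pverts D) \<pi> a)) else a)" for a
  have p: "p (\<pi> u) = \<pi> (\<sigma> u)" if u: "u \<in> pverts D" for u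
  proof -
    have *: "\<pi> u \<in> \<pi> ` pverts D" using u by blast
    show ?thesis
      using * u inv_into_into[OF *] f_inv_into_f[OF *]
      by (simp add: p_def aut_preserves_fibres[OF \<sigma>] flip: onto)
  qed
  have "bij_betw p (pverts Q) (pverts Q)"
    unfolding bij_betw_def
  proof
    show "inj_on p (pverts Q)"
      unfolding onto[symmetric] by (auto intro!: inj_onI simp: p aut_preserves_fibres[OF \<sigma>])
    have "p ` pverts Q = \<pi> ` \<sigma> ` pverts D"
      unfolding onto[symmetric] image_image by (rule image_cong) (simp_all add: p)
    then show "p ` pverts Q = pverts Q" by (simp add: permutes_image[OF perm] onto)
  qed
  then have "p permutes pverts Q" by (rule bij_imp_permutes) (simp add: p_def)
  moreover have "(a, b) \<in> parcs Q \<longleftrightarrow> (p a, p b) \<in> parcs Q"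
    if "a \<in> pverts Q" "b \<in> pverts Q" for a b
    using that by (auto simp flip: onto simp: p mem arc arc_iff[symmetric])
  ultimately have "p \<in> digraph_aut Q" by (simp add: digraph_aut_def)
  moreover have "covers \<sigma> p" using p by (simp add: covers_def)
  ultimately show thesis by (rule that)
qed

lemma aut_lifts:
  assumes "\<sigma> permutes pverts D" and "p \<in> digraph_aut Q" and "covers \<sigma> p"
  shows "\<sigma> \<in> digraph_aut D"
proof -
  have "(u, v) \<in> parcs D \<longleftrightarrow> (\<sigma> u, \<sigma> v) \<in> parcs D" if uv: "u \<in> pverts D" "v \<in> pverts D" for u v
  proof -
    have "\<pi> u \<in> pverts Q" "\<pi> v \<in> pverts Q" using uv by (auto simp flip: onto)
    then show ?thesis
      using uv assms by (simp add: arc_iff permutes_in_image digraph_aut_def covers_def)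
  qed
  then show ?thesis using assms(1) by (simp add: digraph_aut_def)
qed

lemma fibre_labelling:
  obtains \<phi> where "bij_betw \<phi> (pverts D) (pverts Q \<times> {1..m})"
    "\<forall>u\<in>pverts D. fst (\<phi> u) = \<pi> u"
proof -
  have "\<exists>l. bij_betw l {v \<in> pverts D. \<pi> v = a} {1..m}" if "a \<in> pverts Q" for a
    using card_fibre[OF that] finite_verts by (intro finite_same_card_bij) auto
  then obtain l where l: "\<And>a. a \<in> pverts Q \<Longrightarrow> bij_betw (l a) {v \<in> pverts D. \<pi> v = a} {1..m}"
    by metis
  define \<phi> where "\<phi> u = (\<pi> u, l (\<pi> u) u)" for u
  have "bij_betw \<phi> (pverts D) (pverts Q \<times> {1..m})"
    unfolding bij_betw_def
  proof
    show "inj_on \<phi> (pverts D)"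
    proof
      fix u v assume uv: "u \<in> pverts D" "v \<in> pverts D" "\<phi> u = \<phi> v"
      have "inj_on (l (\<pi> u)) {w \<in> pverts D. \<pi> w = \<pi> u}"
        using l[of "\<pi> u"] uv onto by (auto simp: bij_betw_def)
      then show "u = v" using uv by (auto simp: \<phi>_def dest: inj_onD)
    qed
    show "\<phi> ` pverts D = pverts Q \<times> {1..m}"
    proof (intro equalityI subsetI)
      fix x assume "x \<in> \<phi> ` pverts D"
      then obtain u where u: "u \<in> pverts D" "x = \<phi> u" by blast
      then have "\<pi> u \<in> pverts Q" using onto by blast
      then show "x \<in> pverts Q \<times> {1..m}"
        using bij_betwE[OF l[of "\<pi> u"]] u by (auto simp: \<phi>_def)
    next
      fix x assume "x \<in> pverts Q \<times> {1..m}"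
      then obtain a i where x: "x = (a, i)" "a \<in> pverts Q" "i \<in> {1..m}" by blast
      then have "i \<in> l a ` {v \<in> pverts D. \<pi> v = a}" using l[of a] by (auto simp: bij_betw_def)
      then show "x \<in> \<phi> ` pverts D" using x by (auto simp: \<phi>_def)
    qed
  qed
  then show thesis using that by (simp add: \<phi>_def)
qed

text \<open>
  In fibre coordinates \<open>\<phi>\<close>, lying in the wreath product means permuting the first coordinates
  by an automorphism of \<open>Q\<close>; the second coordinates are then automatically permuted within
  each fibre, because the whole map is injective and the fibres are finite.
\<close>

lemma wreath_iff_aut:
  assumes \<phi>: "bij_betw \<phi> (pverts D) (pverts Q \<times> {1..m})"
    and fst_\<phi>: "\<forall>u\<in>pverts D. fst (\<phi> u) = \<pi> u"
    and \<sigma>: "\<sigma> permutes pverts D" and \<tau>: "\<tau> permutes (pverts Q \<times> {1..m})"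
    and equiv: "\<forall>u\<in>pverts D. \<tau> (\<phi> u) = \<phi> (\<sigma> u)"
  shows "\<sigma> \<in> digraph_aut D \<longleftrightarrow>
    \<tau> \<in> wreath_product (pverts Q) (digraph_aut Q) {1..m} (carrier (sym_group m))"
proof
  assume "\<sigma> \<in> digraph_aut D"
  then obtain p where p: "p \<in> digraph_aut Q"
    and p\<pi>: "covers \<sigma> p" by (rule aut_descends)
  have fst_\<tau>: "fst (\<tau> (a, i)) = p a" if ai: "a \<in> pverts Q" "i \<in> {1..m}" for a i
  proof -
    have "(a, i) \<in> \<phi> ` pverts D" using ai \<phi> by (simp add: bij_betw_def)
    then obtain u where u: "u \<in> pverts D" "\<phi> u = (a, i)" by auto
    then have "\<sigma> u \<in> pverts D" using \<sigma> by (simp add: permutes_in_image)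
    then show ?thesis using u fst_\<phi> equiv p\<pi> by (force simp: covers_def)
  qed
  define q where "q a i = (if i \<in> {1..m} then snd (\<tau> (a, i)) else i)" for a i
  have "q a permutes {1..m}" if a: "a \<in> pverts Q" for a
  proof -
    have "q a ` {1..m} \<subseteq> {1..m}"
    proof
      fix j assume "j \<in> q a ` {1..m}"
      then obtain i where i: "i \<in> {1..m}" "j = snd (\<tau> (a, i))" by (auto simp: q_def)
      then have "\<tau> (a, i) \<in> pverts Q \<times> {1..m}" using a permutes_in_image[OF \<tau>] by blast
      then show "j \<in> {1..m}" using i by (metis mem_Times_iff)
    qed
    moreover have "inj_on (q a) {1..m}"
    proof
      fix i j assume ij: "i \<in> {1..m}" "j \<in> {1..m}" "q a i = q a j"
      then have "\<tau> (a, i) = \<tau> (a, j)" using a fst_\<tau> by (intro prod_eqI) (auto simp: q_def)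
      then show "i = j" using permutes_inj[OF \<tau>] by (auto dest: injD)
    qed
    ultimately have "bij_betw (q a) {1..m} {1..m}"
      by (simp add: bij_betw_def endo_inj_surj)
    then show ?thesis by (rule bij_imp_permutes) (simp only: q_def if_False)
  qed
  moreover have "\<tau> (a, i) = (p a, q a i)" if "a \<in> pverts Q" "i \<in> {1..m}" for a i
    using that fst_\<tau>[OF that] by (intro prod_eqI) (auto simp: q_def)
  ultimately show "\<tau> \<in> wreath_product (pverts Q) (digraph_aut Q) {1..m} (carrier (sym_group m))"
    unfolding wreath_product_def using \<tau> p by (auto simp del: atLeastAtMost_iff simp: sym_group_def intro!: bexI[of _ p] exI[of _ q])
next
  assume "\<tau> \<in> wreath_product (pverts Q) (digraph_aut Q) {1..m} (carrier (sym_group m))"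
  then obtain p q where p: "p \<in> digraph_aut Q"
    and pq: "\<And>a i. \<lbrakk>a \<in> pverts Q; i \<in> {1..m}\<rbrakk> \<Longrightarrow> \<tau> (a, i) = (p a, q a i)"
    unfolding wreath_product_def by blast
  have "covers \<sigma> p"
    unfolding covers_def
  proof
    fix u assume u: "u \<in> pverts D"
    then have "\<phi> u \<in> pverts Q \<times> {1..m}" "\<sigma> u \<in> pverts D"
      using bij_betwE[OF \<phi>] \<sigma> by (auto simp: permutes_in_image)
    then have "fst (\<tau> (\<phi> u)) = p (fst (\<phi> u))"
      using pq[of "fst (\<phi> u)" "snd (\<phi> u)"] by (simp add: mem_Times_iff)
    then show "p (\<pi> u) = \<pi> (\<sigma> u)"
      using u \<open>\<sigma> u \<in> pverts D\<close> equiv fst_\<phi> by simp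
  qed
  then show "\<sigma> \<in> digraph_aut D" by (rule aut_lifts[OF \<sigma> p])
qed

theorem aut_perm_isomorphic_wreath:
  "perm_isomorphic (pverts D) (digraph_aut D) (pverts Q \<times> {1..m})
    (wreath_product (pverts Q) (digraph_aut Q) {1..m} (carrier (sym_group m)))"
proof -
  obtain \<phi> where \<phi>: "bij_betw \<phi> (pverts D) (pverts Q \<times> {1..m})"
    "\<forall>u\<in>pverts D. fst (\<phi> u) = \<pi> u" by (rule fibre_labelling)
  show ?thesis
  proof (rule perm_isomorphicI[OF \<phi>(1)])
    fix \<sigma> \<tau> assume "\<sigma> permutes pverts D" "\<tau> permutes pverts Q \<times> {1..m}"
      "\<And>u. u \<in> pverts D \<Longrightarrow> \<tau> (\<phi> u) = \<phi> (\<sigma> u)"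
    then show "\<sigma> \<in> digraph_aut D \<longleftrightarrow>
      \<tau> \<in> wreath_product (pverts Q) (digraph_aut Q) {1..m} (carrier (sym_group m))"
      by (intro wreath_iff_aut[OF \<phi>]) auto
  qed (auto simp: digraph_aut_def wreath_product_def)
qed

text \<open>
  Equal fibre sizes give a lift: act on the first coordinate of a labelling and keep the label.
\<close>

lemma quotient_aut_lifts:
  assumes p: "p \<in> digraph_aut Q"
  obtains \<sigma> where "\<sigma> \<in> digraph_aut D" "covers \<sigma> p"
proof -
  obtain \<phi> where \<phi>: "bij_betw \<phi> (pverts D) (pverts Q \<times> {1..m})"
    and fst_\<phi>: "\<forall>u\<in>pverts D. fst (\<phi> u) = \<pi> u" by (rule fibre_labelling)
  have perm: "p permutes pverts Q" using p by (simp add: digraph_aut_def)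
  define \<psi> where "\<psi> = inv_into (pverts D) \<phi>"
  define \<sigma> where "\<sigma> u = (if u \<in> pverts D then \<psi> (map_prod p id (\<phi> u)) else u)" for u
  have \<psi>: "bij_betw \<psi> (pverts Q \<times> {1..m}) (pverts D)"
    unfolding \<psi>_def using \<phi> by (rule bij_betw_inv_into)
  have "bij_betw (map_prod p id) (pverts Q \<times> {1..m}) (pverts Q \<times> {1..m})"
    using permutes_imp_bij[OF perm] by (intro bij_betw_map_prod) (auto simp: bij_betw_def)
  then have "bij_betw (\<psi> \<circ> map_prod p id \<circ> \<phi>) (pverts D) (pverts D)"
    using \<phi> \<psi> by (metis bij_betw_trans comp_assoc)
  then have "bij_betw \<sigma> (pverts D) (pverts D)"
    by (rule bij_betw_cong[THEN iffD1, rotated]) (simp add: \<sigma>_def)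
  then have \<sigma>: "\<sigma> permutes pverts D" by (rule bij_imp_permutes) (simp add: \<sigma>_def)
  have *: "p (\<pi> u) = \<pi> (\<sigma> u)" if u: "u \<in> pverts D" for u
  proof -
    have \<sigma>u: "\<sigma> u \<in> pverts D" using u \<sigma> by (simp add: permutes_in_image)
    have "\<phi> u \<in> pverts Q \<times> {1..m}" using bij_betwE[OF \<phi>] u by blast
    then have "map_prod p id (\<phi> u) \<in> pverts Q \<times> {1..m}"
      using permutes_in_image[OF perm] by (auto simp: map_prod_def)
    then have "\<phi> (\<sigma> u) = map_prod p id (\<phi> u)"
      using \<phi> u by (simp add: \<sigma>_def \<psi>_def bij_betw_inv_into_right)
    then show ?thesis using fst_\<phi> u \<sigma>u by (metis fst_map_prod)
  qed
  then have cov: "covers \<sigma> p" by (simp add: covers_def)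
  show thesis using that[OF aut_lifts[OF \<sigma> p cov] cov] .
qed

end

text \<open>
  The situation where the vertices of \<open>Q\<close> are themselves the fibres of \<open>\<pi>\<close>, as for
  \<open>g \<mapsto> gK\<close> on the Cayley digraph. The permutation that \<open>\<sigma>\<close> induces on the blocks is then literally
  the automorphism of \<open>Q\<close> that it covers.
\<close>

locale twin_partition = twin_quotient D Q \<pi> m
  for D :: "'v pair_pre_digraph" and Q :: "'v set pair_pre_digraph" and \<pi> m +
  assumes fibre_eq: "B \<in> pverts Q \<Longrightarrow> {v \<in> pverts D. \<pi> v = B} = B"
begin

lemma aut_image_fibre:
  assumes \<sigma>: "\<sigma> \<in> digraph_aut D" and cov: "covers \<sigma> p"
    and pQ: "p \<in> digraph_aut Q" and B: "B \<in> pverts Q"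
  shows "\<sigma> ` B = p B"
proof -
  have perm: "\<sigma> permutes pverts D" using \<sigma> by (simp add: digraph_aut_def)
  have pp: "p permutes pverts Q" using pQ by (simp add: digraph_aut_def)
  have p: "p (\<pi> u) = \<pi> (\<sigma> u)" if "u \<in> pverts D" for u
    using cov that by (simp add: covers_def)
  have "\<sigma> ` {v \<in> pverts D. \<pi> v = B} = {v \<in> pverts D. \<pi> v = p B}"
  proof (intro equalityI subsetI)
    fix v assume "v \<in> \<sigma> ` {v \<in> pverts D. \<pi> v = B}"
    then show "v \<in> {v \<in> pverts D. \<pi> v = p B}" using p perm by (auto simp: permutes_in_image)
  next
    fix v assume v: "v \<in> {v \<in> pverts D. \<pi> v = p B}"
    then have "v \<in> \<sigma> ` pverts D" using permutes_image[OF perm] by simp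
    then obtain u where u: "u \<in> pverts D" "v = \<sigma> u" by blast
    then have "p (\<pi> u) = p B" using v p by simp
    then have "\<pi> u = B" using permutes_inj[OF pp] by (auto dest: injD)
    then show "v \<in> \<sigma> ` {v \<in> pverts D. \<pi> v = B}" using u by blast
  qed
  then show ?thesis using fibre_eq B permutes_in_image[OF pp] by simp
qed

lemma induced_on_fibres_eq_aut: "induced_on_blocks (digraph_aut D) (pverts Q) = digraph_aut Q"
proof (intro equalityI subsetI)
  have eqI: "(\<lambda>B. if B \<in> pverts Q then \<sigma> ` B else B) = p"
    if "\<sigma> \<in> digraph_aut D" "p \<in> digraph_aut Q" "covers \<sigma> p" for \<sigma> p
  proof
    fix B
    have "p permutes pverts Q" using that(2) by (simp add: digraph_aut_def)
    then show "(if B \<in> pverts Q then \<sigma> ` B else B) = p B"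
      using aut_image_fibre[OF that(1,3,2)] by (simp add: permutes_not_in)
  qed
  {
    fix p assume "p \<in> induced_on_blocks (digraph_aut D) (pverts Q)"
    then obtain \<sigma> where \<sigma>: "\<sigma> \<in> digraph_aut D" "p = (\<lambda>B. if B \<in> pverts Q then \<sigma> ` B else B)"
      by (auto simp: induced_on_blocks_def)
    obtain r where "r \<in> digraph_aut Q" "covers \<sigma> r"
      using aut_descends[OF \<sigma>(1)] by blast
    then show "p \<in> digraph_aut Q" using eqI[OF \<sigma>(1)] \<sigma>(2) by simp
  next
    fix p assume p: "p \<in> digraph_aut Q"
    then obtain \<sigma> where \<sigma>: "\<sigma> \<in> digraph_aut D" "covers \<sigma> p"
      using quotient_aut_lifts[OF p] by blast
    show "p \<in> induced_on_blocks (digraph_aut D) (pverts Q)"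
      unfolding induced_on_blocks_def using eqI[OF \<sigma>(1) p \<sigma>(2)] \<sigma>(1) by blast
  }
qed

lemma fibres_block_system:
  assumes "transitive_perms (pverts D) (digraph_aut D)"
  shows "block_system (pverts D) (digraph_aut D) (pverts Q)"
  unfolding block_system_def
proof (intro conjI ballI assms)
  show "partition_on (pverts D) (pverts Q)"
  proof (rule partition_onI)
    show "\<Union> (pverts Q) = pverts D"
    proof (intro equalityI subsetI)
      fix v assume "v \<in> \<Union> (pverts Q)" then show "v \<in> pverts D" using fibre_eq by blast
    next
      fix v assume v: "v \<in> pverts D"
      then have "\<pi> v \<in> pverts Q" using onto by blast
      then show "v \<in> \<Union> (pverts Q)" using fibre_eq[of "\<pi> v"] v by blast
    qed
    show "disjnt B C" if "B \<in> pverts Q" "C \<in> pverts Q" "B \<noteq> C" for B C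
      using that fibre_eq[of B] fibre_eq[of C] by (auto simp: disjnt_def)
    show "{} \<notin> pverts Q"
    proof
      assume *: "{} \<in> pverts Q"
      then have "{} \<in> \<pi> ` pverts D" by (simp add: onto)
      then show False using fibre_eq[OF *] by auto
    qed
  qed
  fix \<sigma> B assume \<sigma>: "\<sigma> \<in> digraph_aut D" and B: "B \<in> pverts Q"
  obtain p where p: "p \<in> digraph_aut Q" "covers \<sigma> p"
    using aut_descends[OF \<sigma>] by blast
  have "p permutes pverts Q" using p(1) by (simp add: digraph_aut_def)
  then show "\<sigma> ` B \<in> pverts Q"
    using aut_image_fibre[OF \<sigma> p(2,1) B] B by (simp add: permutes_in_image)
qed

end

section \<open>Arcs and twins in coset and Cayley digraphs\<close>

context group
begin

lemma inv_mult_cancel: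
  assumes "a \<in> carrier G" "b \<in> carrier G"
  shows "inv a \<otimes> (a \<otimes> b) = b" "a \<otimes> (inv a \<otimes> b) = b"
  using assms by (simp_all flip: m_assoc)

lemma mem_bi_invariant:
  assumes "subgroup K G" "S \<subseteq> carrier G" "S = K <#> S <#> K" "k \<in> K" "s \<in> S"
  shows "k \<otimes> s \<in> S" "s \<otimes> k \<in> S"
proof -
  have one: "\<one> \<in> K" and c: "k \<in> carrier G" "s \<in> carrier G"
    using assms subgroup.one_closed subgroup.mem_carrier by auto
  have mem: "x \<otimes> s \<otimes> y \<in> S" if "x \<in> K" "y \<in> K" for x y
    using that assms(5) by (subst assms(3)) (auto simp: set_mult_def)
  show "k \<otimes> s \<in> S" "s \<otimes> k \<in> S" using mem[of k \<one>] mem[of \<one> k] one assms(4) c by auto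
qed

lemma l_coset_eq_iff:
  assumes K: "subgroup K G" and "a \<in> carrier G" "b \<in> carrier G"
  shows "a <# K = b <# K \<longleftrightarrow> inv a \<otimes> b \<in> K"
proof
  assume "a <# K = b <# K"
  then have "b \<in> a <# K" using lcos_self[OF assms(3) K] by simp
  then show "inv a \<otimes> b \<in> K" by (rule subgroup.lcos_module_imp[OF K is_group assms(2)])
next
  assume "inv a \<otimes> b \<in> K"
  then have "b \<in> a <# K" by (rule subgroup.lcos_module_rev[OF K is_group assms(2,3)])
  then show "a <# K = b <# K" by (rule l_repr_independence[OF _ assms(2) K])
qed

text \<open>
  Arcs between cosets can be tested on arbitrary representatives, because changing them
  multiplies \<open>a\<^sup>-\<^sup>1b\<close> by elements of \<open>K\<close> on both sides.
\<close>

lemma double_coset_arc_iff: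
  assumes K: "subgroup K G" and S: "S \<subseteq> carrier G" "S = K <#> S <#> K"
    and ab: "a \<in> carrier G" "b \<in> carrier G"
  shows "(a <# K, b <# K) \<in> parcs (double_coset_digraph G K S) \<longleftrightarrow> inv a \<otimes> b \<in> S"
proof
  assume "(a <# K, b <# K) \<in> parcs (double_coset_digraph G K S)"
  then obtain g s where gs: "g \<in> carrier G" "s \<in> S"
    "a <# K = g <# K" "b <# K = (g \<otimes> s) <# K" by (auto simp: double_coset_digraph_def)
  have s: "s \<in> carrier G" using gs S by blast
  have 1: "inv a \<otimes> g \<in> K" and 2: "inv (g \<otimes> s) \<otimes> b \<in> K"
    using gs s ab by (simp_all flip: l_coset_eq_iff[OF K])
  have "inv a \<otimes> b = (inv a \<otimes> g) \<otimes> s \<otimes> (inv (g \<otimes> s) \<otimes> b)"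
    using gs s ab by (simp add: m_assoc inv_mult_group inv_mult_cancel)
  then show "inv a \<otimes> b \<in> S"
    using mem_bi_invariant[OF K S] 1 2 gs(2) by metis
next
  assume s: "inv a \<otimes> b \<in> S"
  have "(a <# K, (a \<otimes> (inv a \<otimes> b)) <# K) \<in> parcs (double_coset_digraph G K S)"
    unfolding double_coset_digraph_def using s ab by auto
  then show "(a <# K, b <# K) \<in> parcs (double_coset_digraph G K S)"
    using ab by (simp add: inv_mult_cancel)
qed

lemma cayley_arc_iff:
  assumes S: "S \<subseteq> carrier G" and ab: "a \<in> carrier G" "b \<in> carrier G"
  shows "(a, b) \<in> parcs (cayley_digraph G S) \<longleftrightarrow> inv a \<otimes> b \<in> S"
proof
  assume "(a, b) \<in> parcs (cayley_digraph G S)"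
  then obtain s where "s \<in> S" "b = a \<otimes> s" by (auto simp: cayley_digraph_def)
  then show "inv a \<otimes> b \<in> S" using S ab by (auto simp: m_assoc[symmetric])
next
  assume s: "inv a \<otimes> b \<in> S"
  have "b = a \<otimes> (inv a \<otimes> b)" using ab by (simp add: inv_mult_cancel)
  then show "(a, b) \<in> parcs (cayley_digraph G S)"
    unfolding cayley_digraph_def using s ab by auto
qed

lemma cayley_aut_transitive:
  assumes S: "S \<subseteq> carrier G"
  shows "transitive_perms (carrier G) (digraph_aut (cayley_digraph G S))"
  unfolding transitive_perms_def
proof (intro ballI)
  fix x y assume xy: "x \<in> carrier G" "y \<in> carrier G"
  \<comment> \<open>Left translations preserve \<open>a\<^sup>-\<^sup>1b\<close>.\<close>
  define t where "t = y \<otimes> inv x"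
  have t: "t \<in> carrier G" using xy by (simp add: t_def)
  define \<sigma> where "\<sigma> g = (if g \<in> carrier G then t \<otimes> g else g)" for g
  have "bij_betw \<sigma> (carrier G) (carrier G)"
    by (rule bij_betwI[where g = "\<lambda>g. inv t \<otimes> g"]) (auto simp: \<sigma>_def t m_assoc[symmetric])
  then have "\<sigma> permutes carrier G" by (rule bij_imp_permutes) (simp add: \<sigma>_def)
  moreover have "inv (\<sigma> a) \<otimes> \<sigma> b = inv a \<otimes> b" if ab: "a \<in> carrier G" "b \<in> carrier G" for a b
  proof -
    show ?thesis using ab t by (simp add: \<sigma>_def inv_mult_group m_assoc inv_mult_cancel)
  qed
  moreover have "\<sigma> a \<in> carrier G" if "a \<in> carrier G" for a using that t by (simp add: \<sigma>_def)
  moreover have "pverts (cayley_digraph G S) = carrier G" by (simp add: cayley_digraph_def)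
  ultimately have "\<sigma> \<in> digraph_aut (cayley_digraph G S)"
    by (simp add: digraph_aut_def cayley_arc_iff[OF S])
  moreover have "\<sigma> x = y" using xy by (simp add: \<sigma>_def t_def m_assoc)
  ultimately show "\<exists>\<sigma>\<in>digraph_aut (cayley_digraph G S). \<sigma> x = y" by blast
qed

text \<open>
  The elements \<open>x\<close> with \<open>xS = S = Sx\<close>. Asking for closure of \<open>S\<close> under multiplication with
  both \<open>x\<close> and its inverse gives equality, not only inclusion, for infinite \<open>S\<close> too.
\<close>

definition bi_stabilizer :: "'a set \<Rightarrow> 'a set"
  where "bi_stabilizer S =
    {x \<in> carrier G. \<forall>s\<in>S. x \<otimes> s \<in> S \<and> inv x \<otimes> s \<in> S \<and> s \<otimes> x \<in> S \<and> s \<otimes> inv x \<in> S}"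

lemma subgroup_bi_stabilizer:
  assumes "S \<subseteq> carrier G"
  shows "subgroup (bi_stabilizer S) G"
proof (rule subgroupI)
  show "bi_stabilizer S \<subseteq> carrier G" by (auto simp: bi_stabilizer_def)
  have "\<one> \<in> bi_stabilizer S" using assms by (auto simp: bi_stabilizer_def subset_iff)
  then show "bi_stabilizer S \<noteq> {}" by blast
  show "inv x \<in> bi_stabilizer S" if "x \<in> bi_stabilizer S" for x
    using that by (auto simp: bi_stabilizer_def)
  fix x y assume xy: "x \<in> bi_stabilizer S" "y \<in> bi_stabilizer S"
  then have c: "x \<in> carrier G" "y \<in> carrier G" by (auto simp: bi_stabilizer_def)
  show "x \<otimes> y \<in> bi_stabilizer S"
    unfolding bi_stabilizer_def
  proof (intro CollectI conjI ballI)
    fix s assume s: "s \<in> S"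
    then have sc: "s \<in> carrier G" using assms by blast
    show "x \<otimes> y \<otimes> s \<in> S" "inv (x \<otimes> y) \<otimes> s \<in> S" "s \<otimes> (x \<otimes> y) \<in> S" "s \<otimes> inv (x \<otimes> y) \<in> S"
      using xy s sc c
      by (simp_all add: bi_stabilizer_def inv_mult_group m_assoc)
         (simp_all add: m_assoc[symmetric])
  qed (use c in simp)
qed

lemma bi_stabilizer_invariant:
  assumes "S \<subseteq> carrier G"
  shows "S = bi_stabilizer S <#> S <#> bi_stabilizer S"
proof (intro equalityI subsetI)
  fix s assume s: "s \<in> S"
  have "\<one> \<in> bi_stabilizer S" using subgroup_bi_stabilizer[OF assms] by (rule subgroup.one_closed)
  moreover have "s = \<one> \<otimes> s \<otimes> \<one>" using s assms by auto
  ultimately show "s \<in> bi_stabilizer S <#> S <#> bi_stabilizer S"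
    using s unfolding set_mult_def by blast
next
  fix s assume "s \<in> bi_stabilizer S <#> S <#> bi_stabilizer S"
  then show "s \<in> S" by (auto simp: set_mult_def bi_stabilizer_def)
qed

lemma subset_bi_stabilizer:
  assumes "subgroup K G" "S \<subseteq> carrier G" "S = K <#> S <#> K"
  shows "K \<subseteq> bi_stabilizer S"
  using mem_bi_invariant[OF assms] subgroup.m_inv_closed[OF assms(1)] subgroup.mem_carrier[OF assms(1)]
  by (auto simp: bi_stabilizer_def)

text \<open>
  If \<open>a\<close> and \<open>b\<close> have the same out-neighbours then \<open>aS = bS\<close>, and if they have the same
  in-neighbours then \<open>Sa\<^sup>-\<^sup>1 = Sb\<^sup>-\<^sup>1\<close>; together \<open>a\<^sup>-\<^sup>1b\<close> stabilizes \<open>S\<close> on both sides.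
\<close>

lemma double_coset_twin_free:
  assumes K: "subgroup K G" and S: "S \<subseteq> carrier G" "S = K <#> S <#> K"
    and stab: "bi_stabilizer S \<subseteq> K"
    and ab: "a \<in> carrier G" "b \<in> carrier G"
    and out: "\<And>c. c \<in> carrier G \<Longrightarrow> inv a \<otimes> c \<in> S \<longleftrightarrow> inv b \<otimes> c \<in> S"
    and into: "\<And>c. c \<in> carrier G \<Longrightarrow> inv c \<otimes> a \<in> S \<longleftrightarrow> inv c \<otimes> b \<in> S"
  shows "a <# K = b <# K"
proof -
  have "inv a \<otimes> b \<in> bi_stabilizer S"
    unfolding bi_stabilizer_def
  proof (intro CollectI conjI ballI)
    fix s assume s: "s \<in> S"
    then have c: "s \<in> carrier G" using S by blast
    show "inv a \<otimes> b \<otimes> s \<in> S" "inv (inv a \<otimes> b) \<otimes> s \<in> S"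
      using out[of "b \<otimes> s"] out[of "a \<otimes> s"] s c ab
      by (simp_all add: m_assoc[symmetric] inv_mult_group)
    show "s \<otimes> (inv a \<otimes> b) \<in> S" "s \<otimes> inv (inv a \<otimes> b) \<in> S"
      using into[of "a \<otimes> inv s"] into[of "b \<otimes> inv s"] s c ab
      by (simp_all add: m_assoc inv_mult_group)
  qed (use ab in simp)
  then show ?thesis using stab ab by (auto simp: l_coset_eq_iff[OF K])
qed

lemma l_coset_mult_subgroup:
  assumes "subgroup H G" "subgroup K G" "H \<subseteq> K" "a \<in> carrier G"
  shows "(a <# H) <#> K = a <# K"
proof -
  have "H <#> K = K"
  proof
    show "H <#> K \<subseteq> K"
      using assms(3) subgroup.m_closed[OF assms(2)] by (auto simp: set_mult_def)
    show "K \<subseteq> H <#> K"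
    proof
      fix k assume k: "k \<in> K"
      then have "k = \<one> \<otimes> k" using subgroup.mem_carrier[OF assms(2)] by simp
      then show "k \<in> H <#> K"
        using k subgroup.one_closed[OF assms(1)] unfolding set_mult_def by blast
    qed
  qed
  then show ?thesis
    using assms subgroup.subset by (metis setmult_lcos_assoc)
qed

lemma lcosets_eq_image: "lcosets K = (\<lambda>a. a <# K) ` carrier G"
  by (auto simp: LCOSETS_def)

text \<open>
  Left translation by \<open>a\<close> carries the cosets of \<open>H\<close> inside \<open>K\<close> to the cosets of \<open>H\<close> inside \<open>aK\<close>.
\<close>

lemma card_lcosets_in_l_coset:
  assumes H: "subgroup H G" and K: "subgroup K G" and HK: "H \<subseteq> K" and a: "a \<in> carrier G"
  shows "card {C \<in> lcosets H. C <#> K = a <# K} = card (lcosets\<^bsub>G\<lparr>carrier := K\<rparr>\<^esub> H)"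
proof -
  note Kc = subgroup.mem_carrier[OF K]
  have Hc: "H \<subseteq> carrier G" using H by (rule subgroup.subset)
  have L: "lcosets\<^bsub>G\<lparr>carrier := K\<rparr>\<^esub> H = (\<lambda>k. k <# H) ` K"
    by (auto simp: LCOSETS_def l_coset_def)
  have "bij_betw (\<lambda>C. a <# C) ((\<lambda>k. k <# H) ` K) {C \<in> lcosets H. C <#> K = a <# K}"
    unfolding bij_betw_def
  proof
    show "inj_on (\<lambda>C. a <# C) ((\<lambda>k. k <# H) ` K)"
    proof (rule inj_on_inverseI[where g = "\<lambda>C. inv a <# C"])
      fix C assume "C \<in> (\<lambda>k. k <# H) ` K"
      then have "C \<subseteq> carrier G" using l_coset_subset_G[OF Hc] Kc by auto
      then show "inv a <# (a <# C) = C" using a by (simp add: lcos_m_assoc lcos_mult_one)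
    qed
    show "(\<lambda>C. a <# C) ` (\<lambda>k. k <# H) ` K = {C \<in> lcosets H. C <#> K = a <# K}"
    proof (intro equalityI subsetI)
      fix C assume "C \<in> (\<lambda>C. a <# C) ` (\<lambda>k. k <# H) ` K"
      then obtain k where k: "k \<in> K" "C = (a \<otimes> k) <# H"
        using Kc a Hc by (auto simp: lcos_m_assoc)
      have "C <#> K = (a \<otimes> k) <# K"
        using l_coset_mult_subgroup[OF H K HK] k Kc a by simp
      also have "\<dots> = a <# K"
        using k Kc a by (subst eq_commute) (simp add: l_coset_eq_iff[OF K] m_assoc[symmetric])
      finally show "C \<in> {C \<in> lcosets H. C <#> K = a <# K}"
        using k Kc a by (auto simp: LCOSETS_def)
    next
      fix C assume "C \<in> {C \<in> lcosets H. C <#> K = a <# K}"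
      then obtain b where b: "b \<in> carrier G" "C = b <# H" "(b <# H) <#> K = a <# K"
        by (auto simp: LCOSETS_def)
      then have "a <# K = b <# K" using l_coset_mult_subgroup[OF H K HK] by simp
      then have k: "inv a \<otimes> b \<in> K" using a b by (simp add: l_coset_eq_iff[OF K])
      have "C = a <# ((inv a \<otimes> b) <# H)"
        using a b Hc by (simp add: lcos_m_assoc m_assoc[symmetric])
      then show "C \<in> (\<lambda>C. a <# C) ` (\<lambda>k. k <# H) ` K" using k by blast
    qed
  qed
  then show ?thesis unfolding L by (simp add: bij_betw_same_card)
qed

lemma l_coset_fibre:
  assumes K: "subgroup K G" and a: "a \<in> carrier G"
  shows "{x \<in> carrier G. x <# K = a <# K} = a <# K"
proof (intro equalityI subsetI)
  fix x assume "x \<in> {x \<in> carrier G. x <# K = a <# K}"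
  then show "x \<in> a <# K" using lcos_self[OF _ K] by auto
next
  fix x assume x: "x \<in> a <# K"
  then have "x \<in> carrier G" using l_coset_subset_G[OF subgroup.subset[OF K] a] by blast
  then show "x \<in> {x \<in> carrier G. x <# K = a <# K}"
    using l_repr_independence[OF x a K] by simp
qed

end

section \<open>Automorphisms of double coset digraphs\<close>

theorem corollary4p10:
  fixes G :: "('a, 'b) monoid_scheme" (structure)
    and H K S :: "'a set" and \<B> :: "'a set set" and n :: nat
  assumes "group G" and "finite (carrier G)"
    and "subgroup H G"
    and "S \<subseteq> carrier G" and "S = H <#> S <#> H" and "S \<inter> H = {}"
    and "subgroup K G" and "H \<subseteq> K" and "S = K <#> S <#> K"
    and K_maximal: "\<And>L. \<lbrakk>subgroup L G; H \<subseteq> L; S = L <#> S <#> L; K \<subseteq> L\<rbrakk> \<Longrightarrow> L = K"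
    and "\<B> = lcosets K"
    and "n = card (lcosets\<^bsub>G\<lparr>carrier := K\<rparr>\<^esub> H)"
  shows "block_system (carrier G) (digraph_aut (cayley_digraph G S)) \<B> \<and>
    perm_isomorphic
      (lcosets H) (digraph_aut (double_coset_digraph G H S))
      (\<B> \<times> {1..n})
      (wreath_product \<B> (induced_on_blocks (digraph_aut (cayley_digraph G S)) \<B>)
         {1..n} (carrier (sym_group n)))"
proof -
  interpret group G by fact
  note H = \<open>subgroup H G\<close> and K = \<open>subgroup K G\<close> and HK = \<open>H \<subseteq> K\<close> and S = \<open>S \<subseteq> carrier G\<close>
    and SH = \<open>S = H <#> S <#> H\<close> and SK = \<open>S = K <#> S <#> K\<close>
  have K_sub: "K \<subseteq> bi_stabilizer S" using subset_bi_stabilizer[OF K S SK] .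
  have stab: "bi_stabilizer S = K"
    using HK K_sub by (intro K_maximal subgroup_bi_stabilizer bi_stabilizer_invariant S) auto
  let ?Q = "double_coset_digraph G K S"
  have vQ: "pverts (double_coset_digraph G L S) = (\<lambda>a. a <# L) ` carrier G" for L
    by (simp add: double_coset_digraph_def lcosets_eq_image)
  have vC: "pverts (cayley_digraph G S) = carrier G" by (simp add: cayley_digraph_def)
  note arcK = double_coset_arc_iff[OF K S SK] and arcH = double_coset_arc_iff[OF H S SH]
  have twin_free: "A = B" if AB: "A \<in> pverts ?Q" "B \<in> pverts ?Q"
    and out: "\<And>C. C \<in> pverts ?Q \<Longrightarrow> (A, C) \<in> parcs ?Q \<longleftrightarrow> (B, C) \<in> parcs ?Q"
    and into: "\<And>C. C \<in> pverts ?Q \<Longrightarrow> (C, A) \<in> parcs ?Q \<longleftrightarrow> (C, B) \<in> parcs ?Q" for A B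
  proof -
    obtain a b where ab: "a \<in> carrier G" "b \<in> carrier G" and [simp]: "A = a <# K" "B = b <# K"
      using AB by (auto simp: vQ)
    have "a <# K = b <# K"
    proof (rule double_coset_twin_free[OF K S SK _ ab])
      show "bi_stabilizer S \<subseteq> K" by (simp add: stab)
      show "inv a \<otimes> c \<in> S \<longleftrightarrow> inv b \<otimes> c \<in> S" "inv c \<otimes> a \<in> S \<longleftrightarrow> inv c \<otimes> b \<in> S"
        if "c \<in> carrier G" for c
        using out[of "c <# K"] into[of "c <# K"] that ab by (simp_all add: vQ arcK)
    qed
    then show ?thesis by simp
  qed
  have cay: "twin_partition (cayley_digraph G S) ?Q (\<lambda>a. a <# K) (card K)"
  proof (unfold_locales, goal_cases)
    case (4 A B) then show ?case by (rule twin_free)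
  next
    case (5 A)
    then obtain a where a: "a \<in> carrier G" "A = a <# K" by (auto simp: vQ)
    have "card (a <# K) = card K"
      using a l_card_cosets_equal[of "a <# K"] subgroup.subset[OF K] assms(2)
      by (simp add: lcosets_eq_image)
    then show ?case using a l_coset_fibre[OF K] by (simp add: vC)
  next
    case (6 A) then show ?case using l_coset_fibre[OF K] by (auto simp: vC vQ)
  qed (simp_all add: vC vQ arcK cayley_arc_iff[OF S] assms(2))
  have cos: "twin_quotient (double_coset_digraph G H S) ?Q (\<lambda>C. C <#> K) n"
  proof (unfold_locales, goal_cases)
    case 1 then show ?case using assms(2) by (simp add: vQ)
  next
    case 2 then show ?case
      by (simp add: vQ image_image l_coset_mult_subgroup[OF H K HK])
  next
    case 3 then show ?case
      by (auto simp: vQ l_coset_mult_subgroup[OF H K HK] arcH arcK)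
  next
    case (4 A B) then show ?case by (rule twin_free)
  next
    case (5 A)
    then obtain a where "a \<in> carrier G" "A = a <# K" by (auto simp: vQ)
    then show ?case
      using card_lcosets_in_l_coset[OF H K HK] assms(12) by (simp add: double_coset_digraph_def)
  qed
  have \<B>: "\<B> = pverts ?Q" and vH: "lcosets H = pverts (double_coset_digraph G H S)"
    by (simp_all add: assms(11) double_coset_digraph_def)
  show ?thesis
    using twin_partition.fibres_block_system[OF cay] cayley_aut_transitive[OF S]
      twin_quotient.aut_perm_isomorphic_wreath[OF cos]
    unfolding \<B> vH twin_partition.induced_on_fibres_eq_aut[OF cay] vC by blast
qed

end
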